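(* Let $m\le0$ be an integer. Let $\lambda\in\mathbb{R}^d$ be a vector with nonnegative decreasing entries, $t_0=\operatorname{tr}\lambda$, and $t\in[t_0,+\infty)$. Consider the vector $$\nu=\nu_\lambda(t)=\big(\lambda_1,\dots,\lambda_{r_\lambda(t)},c_\lambda(t),\dots,c_\lambda(t)\big)\in\mathbb{R}^d\quad\text{if }r_\lambda(t)>0,$$ or $\nu=\frac{t}{d}\,\mathbf{1}_d=c_\lambda(t)\,\mathbf{1}_d$ if $r_\lambda(t)=0$. Then $$\nu\in\Lambda_t(\lambda,m),\qquad\operatorname{tr}\nu=t,\qquad\text{and}\quad\nu\prec_w\mu\ \text{ for every }\mu\in\Lambda_t(\lambda,m).$$
   Context: $\operatorname{tr}$ of a vector is the sum of its entries; $\mathbf{1}_d$ is the all-ones vector. $\mathbb{R}_+^{d\,\downarrow}$ is the set of vectors in $\mathbb{R}^d$ with nonnegative decreasing entries. For $m\le0$ and $t\ge\operatorname{tr}\lambda$, $\Lambda_t(\lambda,m)=\{\mu\in\mathbb{R}_+^{d\,\downarrow}:\mu_i\ge\lambda_i\text{ for }i=1,\dots,d,\ \operatorname{tr}\mu\ge t\}$. $x\prec_w y$ means $\sum_{i=1}^kx_i^\downarrow\le\sum_{i=1}^ky_i^\downarrow$ for $k=1,\dots,d$, where $\downarrow$ denotes decreasing rearrangement. For $t\ge t_0$ and $r\in\{0,\dots,d-1\}$ let $p_\lambda(r,t)=\frac{t-\sum_{j=1}^r\lambda_j}{d-r}$, and $$r_\lambda(t)=\min\{r\in\{0,\dots,d-1\}:p_\lambda(r,t)\ge\lambda_{r+1}\},\qquad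 c_\lambda(t)=p_\lambda(r_\lambda(t),t).$$ *)

theory Defs
  imports Complex_Main
begin

text \<open>Vectors in \<open>\<real>\<^sup>d\<close> are real lists of length \<open>d\<close>. Indices start at 0, so the mathematical entry
  \<open>x\<^sub>i\<close> is \<open>x ! (i - 1)\<close>; the trace of a vector is \<^const>\<open>sum_list\<close>.\<close>

definition nonneg_decreasing :: "nat \<Rightarrow> real list set" where
  "nonneg_decreasing d = {x. length x = d \<and> sorted_wrt (\<ge>) x \<and> (\<forall>a\<in>set x. 0 \<le> a)}"

definition decreasing_rearrangement :: "real list \<Rightarrow> real list" where
  "decreasing_rearrangement x = rev (sort x)"

definition weakly_submajorized :: "real list \<Rightarrow> real list \<Rightarrow> bool"  (infix "\<prec>\<^sub>w" 50) where
  "x \<prec>\<^sub>w y \<longleftrightarrow> length x = length y \<and>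
     (\<forall>k\<in>{1..length x}. (\<Sum>i<k. decreasing_rearrangement x ! i)
                         \<le> (\<Sum>i<k. decreasing_rearrangement y ! i))"

text \<open>Only \<open>m \<le> 0\<close> is considered, and there the set does not depend on \<open>m\<close>; the other values of \<open>m\<close>
  are left unspecified.\<close>

definition Lambda_set :: "real \<Rightarrow> real list \<Rightarrow> int \<Rightarrow> real list set" where
  "Lambda_set t lam m =
     (if m \<le> 0
      then {\<mu> \<in> nonneg_decreasing (length lam).
              (\<forall>i<length lam. \<mu> ! i \<ge> lam ! i) \<and> sum_list \<mu> \<ge> t}
      else undefined)"

definition p_fun :: "real list \<Rightarrow> nat \<Rightarrow> real \<Rightarrow> real" where
  "p_fun lam r t = (t - (\<Sum>j<r. lam ! j)) / (real (length lam) - real r)"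

text \<open>Because of the index shift, \<open>\<lambda>\<^bsub>r+1\<^esub>\<close> is \<open>lam ! r\<close>.\<close>

definition r_fun :: "real list \<Rightarrow> real \<Rightarrow> nat" where
  "r_fun lam t = Min {r \<in> {..<length lam}. p_fun lam r t \<ge> lam ! r}"

definition c_fun :: "real list \<Rightarrow> real \<Rightarrow> real" where
  "c_fun lam t = p_fun lam (r_fun lam t) t"

definition nu_vec :: "real list \<Rightarrow> real \<Rightarrow> real list" where
  "nu_vec lam t =
     (if r_fun lam t > 0
      then take (r_fun lam t) lam @ replicate (length lam - r_fun lam t) (c_fun lam t)
      else replicate (length lam) (t / real (length lam)))"

lemma nu_vec_r_eq_0:
  assumes "r_fun lam t = 0"
  shows "nu_vec lam t = replicate (length lam) (c_fun lam t)"
  using assms by (simp add: nu_vec_def c_fun_def p_fun_def)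

text \<open>The minimum defining \<^const>\<open>r_fun\<close> is taken over a nonempty set.\<close>

lemma r_fun_set_nonempty:
  assumes "length lam \<ge> 1" and "t \<ge> sum_list lam"
  shows "{r \<in> {..<length lam}. p_fun lam r t \<ge> lam ! r} \<noteq> {}"
proof -
  obtain n where n: "length lam = Suc n"
    using assms(1) by (cases "length lam") auto
  have "sum_list lam = (\<Sum>j<n. lam ! j) + lam ! n"
    by (simp add: sum_list_sum_nth n atLeast0LessThan)
  then have "p_fun lam n t \<ge> lam ! n"
    using assms(2) by (simp add: p_fun_def n)
  then show ?thesis
    using n by auto
qed

end

theory Submission
  imports Defs "HOL-Library.Multiset"
begin

text \<open>
  Write \<open>r = r\<^sub>\<lambda>(t)\<close> and \<open>c = c\<^sub>\<lambda>(t)\<close>. Minimality of \<open>r\<close> gives \<open>\<lambda>\<^bsub>r+1\<^esub> \<le> c\<close>, and \<open>c < \<lambda>\<^sub>r\<close> if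
  \<open>r > 0\<close>, so \<open>\<nu>\<close> is decreasing and dominates \<open>\<lambda>\<close>, and \<open>c\<close> is chosen so that \<open>tr \<nu> = t\<close>. For
  \<open>\<mu>\<close> in \<open>\<Lambda>\<^sub>t(\<lambda>,m)\<close> and \<open>k > r\<close> there are two cases. If \<open>\<mu>\<^sub>k \<ge> c\<close>, then \<open>\<mu>\<close> dominates \<open>\<nu>\<close> in the
  first \<open>k\<close> entries. If \<open>\<mu>\<^sub>k < c\<close>, then \<open>\<nu>\<close> dominates \<open>\<mu>\<close> in the remaining entries, and the claim
  follows from \<open>tr \<nu> = t \<le> tr \<mu>\<close>.
\<close>

lemma decreasing_rearrangement_eq_self:
  assumes "sorted_wrt (\<ge>) x"
  shows "decreasing_rearrangement x = x"
proof -
  have "sorted (rev x)"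
    using assms by (simp add: sorted_wrt_rev)
  then have "sort x = rev x"
    by (intro properties_for_sort) simp_all
  then show ?thesis
    by (simp add: decreasing_rearrangement_def)
qed

lemma sum_list_split_at:
  fixes x :: "real list"
  assumes "k \<le> length x"
  shows "sum_list x = (\<Sum>i<k. x ! i) + (\<Sum>i=k..<length x. x ! i)"
  using assms
  by (simp add: sum_list_sum_nth lessThan_atLeast0 sum.atLeastLessThan_concat)

text \<open>Decreasing vectors are their own rearrangement, so plain prefix sums decide the
  relation.\<close>

lemma weakly_submajorizedI:
  assumes "length x = length y"
    and "sorted_wrt (\<ge>) x" "sorted_wrt (\<ge>) y"
    and "\<And>k. 1 \<le> k \<Longrightarrow> k \<le> length x \<Longrightarrow> (\<Sum>i<k. x ! i) \<le> (\<Sum>i<k. y ! i)"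
  shows "x \<prec>\<^sub>w y"
  using assms by (simp add: weakly_submajorized_def decreasing_rearrangement_eq_self)

lemma r_fun_in_set:
  assumes "length lam \<ge> 1" and "t \<ge> sum_list lam"
  shows "r_fun lam t < length lam" and "lam ! r_fun lam t \<le> c_fun lam t"
proof -
  have "r_fun lam t \<in> {r \<in> {..<length lam}. p_fun lam r t \<ge> lam ! r}"
    unfolding r_fun_def using r_fun_set_nonempty[OF assms] by (intro Min_in) auto
  then show "r_fun lam t < length lam" and "lam ! r_fun lam t \<le> c_fun lam t"
    by (auto simp: c_fun_def)
qed

lemma c_fun_less:
  assumes "length lam \<ge> 1" and "t \<ge> sum_list lam" and "r_fun lam t = Suc r"
  shows "c_fun lam t < lam ! r"
proof -
  have r: "Suc r < length lam"
    using r_fun_in_set(1)[OF assms(1,2)] assms(3) by simp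
  have "p_fun lam r t < lam ! r"
  proof (rule ccontr)
    assume "\<not> p_fun lam r t < lam ! r"
    then have "r_fun lam t \<le> r"
      unfolding r_fun_def using r by (intro Min_le) auto
    then show False
      using assms(3) by simp
  qed
  \<comment> \<open>With \<open>n = length lam\<close>, \<open>(n - r) * p_fun lam r t = lam ! r +
    (n - Suc r) * p_fun lam (Suc r) t\<close>. So \<open>p_fun lam r t\<close> is a weighted mean of
    \<open>lam ! r\<close> and \<open>c_fun lam t\<close>, and lies below \<open>lam ! r\<close>
    only if \<open>c_fun lam t\<close> does.\<close>
  then show ?thesis
    using r by (simp add: c_fun_def p_fun_def assms(3) field_simps)
qed

lemma length_nu_vec:
  assumes "length lam \<ge> 1" and "t \<ge> sum_list lam"
  shows "length (nu_vec lam t) = length lam"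
  using r_fun_in_set(1)[OF assms] by (simp add: nu_vec_def)

text \<open>Merges the two branches of \<open>nu_vec\<close>: when \<open>r_fun lam t = 0\<close>,
  the constant \<open>t / d\<close> is \<open>c_fun lam t\<close>, so later proofs need no separate
  case.\<close>

lemma nu_vec_nth:
  assumes "length lam \<ge> 1" and "t \<ge> sum_list lam" and "i < length lam"
  shows "nu_vec lam t ! i = (if i < r_fun lam t then lam ! i else c_fun lam t)"
proof (cases "r_fun lam t = 0")
  case True
  then show ?thesis
    using assms(3) by (simp add: nu_vec_r_eq_0)
next
  case False
  then show ?thesis
    using assms(3) r_fun_in_set(1)[OF assms(1,2)] by (auto simp: nu_vec_def nth_append)
qed

lemma sum_list_nu_vec:
  assumes "length lam \<ge> 1" and "t \<ge> sum_list lam"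
  shows "sum_list (nu_vec lam t) = t"
proof -
  let ?r = "r_fun lam t"
  have r: "?r < length lam"
    by (rule r_fun_in_set(1)[OF assms])
  have "sum_list (nu_vec lam t)
      = (\<Sum>i<?r. nu_vec lam t ! i) + (\<Sum>i=?r..<length lam. nu_vec lam t ! i)"
    using sum_list_split_at[of ?r "nu_vec lam t"] r by (simp add: length_nu_vec[OF assms])
  also have "\<dots> = (\<Sum>i<?r. lam ! i) + (\<Sum>i=?r..<length lam. c_fun lam t)"
    using r by (intro arg_cong2[where f = "(+)"] sum.cong) (auto simp: nu_vec_nth[OF assms])
  \<comment> \<open>The denominator of \<open>c_fun lam t\<close> is exactly the number of entries
    in the constant tail.\<close>
  also have "\<dots> = t"
    using r by (simp add: c_fun_def p_fun_def of_nat_diff)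
  finally show ?thesis .
qed

lemma nu_vec_ge:
  assumes "length lam \<ge> 1" and "t \<ge> sum_list lam" and "sorted_wrt (\<ge>) lam" and "i < length lam"
  shows "lam ! i \<le> nu_vec lam t ! i"
proof (cases "r_fun lam t < i")
  case True
  then have "lam ! i \<le> lam ! r_fun lam t"
    using assms(3,4) by (simp add: sorted_wrt_iff_nth_less)
  then show ?thesis
    using True r_fun_in_set(2)[OF assms(1,2)] by (simp add: nu_vec_nth[OF assms(1,2,4)])
next
  case False
  then show ?thesis
    using r_fun_in_set(2)[OF assms(1,2)] nu_vec_nth[OF assms(1,2,4)]
    by (cases "i = r_fun lam t") auto
qed

lemma sorted_nu_vec:
  assumes "length lam \<ge> 1" and "t \<ge> sum_list lam" and "sorted_wrt (\<ge>) lam"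
  shows "sorted_wrt (\<ge>) (nu_vec lam t)"
  unfolding sorted_wrt_iff_nth_less length_nu_vec[OF assms(1,2)]
proof (intro allI impI)
  fix i j assume ij: "i < j" "j < length lam"
  have dec: "lam ! j \<le> lam ! i" if "i < j" "j < length lam" for i j
    using assms(3) that by (simp add: sorted_wrt_iff_nth_less)
  \<comment> \<open>Only a head entry against a tail entry needs an argument; the last head entry
    \<open>lam ! r\<close> is the smallest of the head and already exceeds
    \<open>c_fun lam t\<close>.\<close>
  have "c_fun lam t \<le> lam ! i" if "i < r_fun lam t"
  proof -
    obtain r where r: "r_fun lam t = Suc r"
      using \<open>i < r_fun lam t\<close> by (cases "r_fun lam t") auto
    have "lam ! r \<le> lam ! i"
      using dec[of i r] that r r_fun_in_set(1)[OF assms(1,2)] by (cases "i = r") auto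
    then show ?thesis
      using c_fun_less[OF assms(1,2) r] by simp
  qed
  then show "nu_vec lam t ! j \<le> nu_vec lam t ! i"
    using ij dec[OF ij] by (simp add: nu_vec_nth[OF assms(1,2)])
qed

lemma nu_vec_in_Lambda_set:
  assumes "length lam \<ge> 1" and "t \<ge> sum_list lam" and "lam \<in> nonneg_decreasing d" and "m \<le> 0"
  shows "nu_vec lam t \<in> Lambda_set t lam m"
proof -
  have dec: "sorted_wrt (\<ge>) lam" and nonneg: "\<And>i. i < length lam \<Longrightarrow> 0 \<le> lam ! i"
    using assms(3) by (auto simp: nonneg_decreasing_def)
  have ge: "lam ! i \<le> nu_vec lam t ! i" if "i < length lam" for i
    using nu_vec_ge[OF assms(1,2) dec that] .
  have "\<forall>a\<in>set (nu_vec lam t). 0 \<le> a"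
    using nonneg ge by (fastforce simp: in_set_conv_nth length_nu_vec[OF assms(1,2)])
  then show ?thesis
    using assms(4) ge sorted_nu_vec[OF assms(1,2) dec]
    by (simp add: Lambda_set_def nonneg_decreasing_def length_nu_vec[OF assms(1,2)]
        sum_list_nu_vec[OF assms(1,2)])
qed

lemma nu_vec_weakly_submajorized:
  assumes "length lam \<ge> 1" and "t \<ge> sum_list lam" and "sorted_wrt (\<ge>) lam"
    and "length \<mu> = length lam" and "sorted_wrt (\<ge>) \<mu>"
    and ge: "\<And>i. i < length lam \<Longrightarrow> lam ! i \<le> \<mu> ! i" and "t \<le> sum_list \<mu>"
  shows "nu_vec lam t \<prec>\<^sub>w \<mu>"
proof (rule weakly_submajorizedI)
  note nth = nu_vec_nth[OF assms(1,2)] and len = length_nu_vec[OF assms(1,2)]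
  have dec: "\<mu> ! j \<le> \<mu> ! i" if "i \<le> j" "j < length lam" for i j
    using assms(4,5) that by (cases "i = j") (auto simp: sorted_wrt_iff_nth_less)
  fix k assume "1 \<le> k" "k \<le> length (nu_vec lam t)"
  \<comment> \<open>\<open>k - 1\<close> is the zero-based position of the last entry in the prefix
    of length \<open>k\<close>; the first inequality records \<open>k > 0\<close>.\<close>
  then have k: "k - 1 < k" "k \<le> length lam"
    by (simp_all add: len)
  show "(\<Sum>i<k. nu_vec lam t ! i) \<le> (\<Sum>i<k. \<mu> ! i)"
  proof (cases "k \<le> r_fun lam t \<or> c_fun lam t \<le> \<mu> ! (k - 1)")
    case True
    \<comment> \<open>Head entries of \<nu> are bounded by \<open>ge\<close>. If the prefix reaches
      the tail, then \<open>c_fun lam t \<le> \<mu> ! (k - 1) \<le> \<mu> ! i\<close>.\<close>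
    have "nu_vec lam t ! i \<le> \<mu> ! i" if "i < k" for i
    proof -
      have "i \<le> k - 1" "k - 1 < length lam"
        using that k by linarith+
      then show ?thesis
        using True that k(2) ge[of i] dec[of i "k - 1"] by (auto simp: nth)
    qed
    then show ?thesis
      by (intro sum_mono) simp
  next
    case False
    \<comment> \<open>Here \<open>k > r_fun lam t\<close>, so every position from \<open>k\<close>
      on carries the value \<open>c_fun lam t\<close>.\<close>
    have "\<mu> ! i \<le> nu_vec lam t ! i" if "k \<le> i" "i < length lam" for i
    proof -
      have "k - 1 \<le> i"
        using that by simp
      then show ?thesis
        using False that dec[of "k - 1" i] by (simp add: nth)
    qed
    then have "(\<Sum>i=k..<length lam. \<mu> ! i) \<le> (\<Sum>i=k..<length lam. nu_vec lam t ! i)"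
      by (intro sum_mono) simp
    moreover have "sum_list (nu_vec lam t) \<le> sum_list \<mu>"
      using assms(7) by (simp add: sum_list_nu_vec[OF assms(1,2)])
    ultimately show ?thesis
      using sum_list_split_at[of k \<mu>] sum_list_split_at[of k "nu_vec lam t"] k(2) assms(4)
      by (simp add: len)
  qed
qed (use assms in \<open>simp_all add: length_nu_vec sorted_nu_vec\<close>)

theorem theorem5p12:
  fixes d :: nat and m :: int and lam :: "real list" and t0 t :: real and \<nu> :: "real list"
  assumes "d \<ge> 1"
    and "m \<le> 0"
    and "lam \<in> nonneg_decreasing d"
    and "t0 = sum_list lam"
    and "t \<in> {t0..}"
    and "\<nu> = nu_vec lam t"
  shows "\<nu> \<in> Lambda_set t lam m \<and> sum_list \<nu> = t \<and> (\<forall>\<mu>\<in>Lambda_set t lam m. \<nu> \<prec>\<^sub>w \<mu>)"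
proof -
  have len: "length lam \<ge> 1" and t: "t \<ge> sum_list lam" and dec: "sorted_wrt (\<ge>) lam"
    using assms by (auto simp: nonneg_decreasing_def)
  have "nu_vec lam t \<prec>\<^sub>w \<mu>" if "\<mu> \<in> Lambda_set t lam m" for \<mu>
    using that assms(2)
    by (intro nu_vec_weakly_submajorized[OF len t dec])
      (auto simp: Lambda_set_def nonneg_decreasing_def)
  then show ?thesis
    using nu_vec_in_Lambda_set[OF len t assms(3,2)] sum_list_nu_vec[OF len t] assms(6) by simp
qed

end
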